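(* In the single-university model with a fixed admission score (fixed $\alpha\in(0,1)$), the ratio of the average type to the average soft skill of admitted students, $\mathbb{E}[t\mid A\ge\tau_A]\,/\,\mathbb{E}[s\mid A\ge\tau_A]$, depends on $\alpha$ but is independent of the university's preference parameter $\beta\in(0,1)$ and of the admission threshold it uses.
   Context: A student has type $t$ and soft skill $s$; $t,s,Z$ are mutually independent standard normal random variables. The university observes the admission score $A=\alpha t+(1-\alpha)s+\sigma_Z Z$ with $\sigma_Z\ge0$, has quality metric $Q=\beta t+(1-\beta)s$ and quality threshold $\tau_Q\in\mathbb{R}$, and admits a student with score $a$ iff $\mathbb{E}[Q\mid A=a]\ge\tau_Q$. Equivalently, with $\sigma_\alpha^2=\alpha^2+(1-\alpha)^2+\sigma_Z^2$, it admits iff $A\ge\tau_A:=\dfrac{\tau_Q\sigma_\alpha^2}{\alpha\beta+(1-\alpha)(1-\beta)}$ (the admission threshold). Average type and average soft skill of admitted students are $\mathbb{E}[t\mid A\ge\tau_A]$ and $\mathbb{E}[s\mid A\ge\tau_A]$. *)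

theory Defs
  imports "HOL-Probability.Probability"
begin

definition admission_score ::
  "real \<Rightarrow> real \<Rightarrow> ('a \<Rightarrow> real) \<Rightarrow> ('a \<Rightarrow> real) \<Rightarrow> ('a \<Rightarrow> real) \<Rightarrow> 'a \<Rightarrow> real" where
  "admission_score \<alpha> \<sigma>\<^sub>Z t s Z = (\<lambda>\<omega>. \<alpha> * t \<omega> + (1 - \<alpha>) * s \<omega> + \<sigma>\<^sub>Z * Z \<omega>)"

definition quality :: "real \<Rightarrow> ('a \<Rightarrow> real) \<Rightarrow> ('a \<Rightarrow> real) \<Rightarrow> 'a \<Rightarrow> real" where
  "quality \<beta> t s = (\<lambda>\<omega>. \<beta> * t \<omega> + (1 - \<beta>) * s \<omega>)"

(* The event that E[Q | A] \<ge> \<tau>_Q, where the conditional expectation is taken with respect to the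
   sigma-algebra generated by the score A.  It depends on the chosen version of E[Q | A] only up to
   a null set, which does not affect probabilities and means. *)
definition admitted ::
  "'a measure \<Rightarrow> ('a \<Rightarrow> real) \<Rightarrow> ('a \<Rightarrow> real) \<Rightarrow> ('a \<Rightarrow> real) \<Rightarrow> real \<Rightarrow> real \<Rightarrow> real \<Rightarrow> real \<Rightarrow> 'a set" where
  "admitted M t s Z \<sigma>\<^sub>Z \<alpha> \<beta> \<tau>\<^sub>Q =
    {\<omega> \<in> space M.
      real_cond_exp M (vimage_algebra (space M) (admission_score \<alpha> \<sigma>\<^sub>Z t s Z) borel)
        (quality \<beta> t s) \<omega> \<ge> \<tau>\<^sub>Q}"

definition admission_threshold :: "real \<Rightarrow> real \<Rightarrow> real \<Rightarrow> real \<Rightarrow> real" where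
  "admission_threshold \<sigma>\<^sub>Z \<alpha> \<beta> \<tau>\<^sub>Q =
    \<tau>\<^sub>Q * (\<alpha>\<^sup>2 + (1 - \<alpha>)\<^sup>2 + \<sigma>\<^sub>Z\<^sup>2) / (\<alpha> * \<beta> + (1 - \<alpha>) * (1 - \<beta>))"

definition above_threshold ::
  "'a measure \<Rightarrow> ('a \<Rightarrow> real) \<Rightarrow> ('a \<Rightarrow> real) \<Rightarrow> ('a \<Rightarrow> real) \<Rightarrow> real \<Rightarrow> real \<Rightarrow> real \<Rightarrow> real \<Rightarrow> 'a set" where
  "above_threshold M t s Z \<sigma>\<^sub>Z \<alpha> \<beta> \<tau>\<^sub>Q =
    {\<omega> \<in> space M. admission_score \<alpha> \<sigma>\<^sub>Z t s Z \<omega> \<ge> admission_threshold \<sigma>\<^sub>Z \<alpha> \<beta> \<tau>\<^sub>Q}"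

(* E[X | E] for an event E of positive probability; the value is 0 if E is a null set. *)
definition event_mean :: "'a measure \<Rightarrow> ('a \<Rightarrow> real) \<Rightarrow> 'a set \<Rightarrow> real" where
  "event_mean M X E = (LINT \<omega>:E|M. X \<omega>) / measure M E"

end

(* For independent centred normals X and Y, integrating x over {x >= c - y} against the density of X
   gives the variance of X times that density at c - y; averaging over Y turns this into a
   convolution, so E[X; X + Y >= c] = Var(X) * f(c) with f the density of X + Y.
   With A = alpha t + (1 - alpha) s + sigma_Z Z this yields E[t; A >= c] = alpha f(c) and
   E[s; A >= c] = (1 - alpha) f(c), whose ratio alpha / (1 - alpha) involves neither beta nor c.
   The same identities say that Q and k A, with k > 0, have equal integrals over all events
   {A >= c}; these generate the sigma-algebra of A, so E[Q | A] = k A almost everywhere and the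
   admission event is the event {A >= tau_A} up to a null set. *)

theory Submission
  imports Defs
begin

section \<open>Truncated first moments of normal variables\<close>

text \<open>The integrand is the derivative of \<open>?F\<close>, a negative multiple of the density
  that tends to 0 at infinity, so the fundamental theorem of calculus leaves only the boundary term
  at \<open>c\<close>.\<close>

lemma truncated_normal_moment:
  fixes \<sigma> c :: real
  assumes \<sigma>: "0 < \<sigma>"
  shows "(LINT x:{c..}|lborel. normal_density 0 \<sigma> x * x) = \<sigma>\<^sup>2 * normal_density 0 \<sigma> c"
proof -
  let ?F = "\<lambda>x. - \<sigma>\<^sup>2 * normal_density 0 \<sigma> x"
  have deriv: "(?F has_vector_derivative normal_density 0 \<sigma> x * x) (at x)" for x
    unfolding has_real_derivative_iff_has_vector_derivative[symmetric] normal_density_def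
    using \<sigma> by (auto intro!: derivative_eq_intros simp: field_simps power2_eq_square)
  have cont: "isCont (\<lambda>x. normal_density 0 \<sigma> x * x) x" for x
    unfolding normal_density_def using \<sigma> by (intro continuous_intros) auto
  have intgbl: "integrable lborel (\<lambda>x. normal_density 0 \<sigma> x * x)"
    using integrable_normal_moment[of \<sigma> 0 1] \<sigma> by simp
  have lim: "(?F \<longlongrightarrow> 0) at_top"
    unfolding normal_density_def using \<sigma> by real_asymp
  have "(LINT x:{c..}|lborel. normal_density 0 \<sigma> x * x) = (LINT x:{c<..}|lborel. normal_density 0 \<sigma> x * x)"
    by (rule set_integral_cong_set)
       (auto simp: set_borel_measurable_def intro!: eventually_mono[OF AE_lborel_singleton[of c]])
  also have "\<dots> = (LBINT x=ereal c..\<infinity>. normal_density 0 \<sigma> x * x)"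
    by (simp add: interval_integral_to_infinity_eq)
  also have "\<dots> = 0 - ?F c"
  proof (rule interval_integral_FTC_integrable[OF _ deriv cont])
    show "set_integrable lborel (einterval (ereal c) \<infinity>) (\<lambda>x. normal_density 0 \<sigma> x * x)"
      using intgbl by (rule set_integrable_subset[of _ UNIV, simplified set_integrable_def, simplified, folded set_integrable_def]) auto
    show "((?F \<circ> real_of_ereal) \<longlongrightarrow> ?F c) (at_right (ereal c))"
      unfolding ereal_tendsto_simps
      using has_vector_derivative_continuous[OF deriv] 
      by (auto simp: continuous_within intro: tendsto_within_subset)
    show "((?F \<circ> real_of_ereal) \<longlongrightarrow> 0) (at_left \<infinity>)"
      unfolding ereal_tendsto_simps using lim .
  qed simp
  finally show ?thesis by simp
qed

lemma (in prob_space) truncated_expectation_indep_normal: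
  fixes X Y :: "'a \<Rightarrow> real"
  assumes indep: "indep_var borel X borel Y"
    and \<sigma>: "0 < \<sigma>" and \<tau>: "0 < \<tau>"
    and X: "distributed M lborel X (normal_density 0 \<sigma>)"
    and Y: "distributed M lborel Y (normal_density 0 \<tau>)"
  shows "(LINT \<omega>:{\<omega> \<in> space M. c \<le> X \<omega> + Y \<omega>}|M. X \<omega>) =
    \<sigma>\<^sup>2 * normal_density 0 (sqrt (\<sigma>\<^sup>2 + \<tau>\<^sup>2)) c"
proof -
  let ?f = "normal_density 0 \<sigma>" and ?g = "normal_density 0 \<tau>"
  let ?h = "\<lambda>p::real \<times> real. indicator {c..} (fst p + snd p) * fst p"
  have [measurable]: "random_variable borel X" "random_variable borel Y"
    using indep indep_var_rv1 indep_var_rv2 by blast+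
  have "indep_var lborel X lborel Y"
    using indep unfolding indep_var_eq by simp
  then have "distributed M (lborel \<Otimes>\<^sub>M lborel) (\<lambda>\<omega>. (X \<omega>, Y \<omega>)) (\<lambda>(x, y). ennreal (?f x) * ennreal (?g y))"
    by (intro distributed_joint_indep sigma_finite_lborel X Y)
  then have XY: "distributed M (lborel \<Otimes>\<^sub>M lborel) (\<lambda>\<omega>. (X \<omega>, Y \<omega>)) (\<lambda>p. ennreal (?f (fst p) * ?g (snd p)))"
    by (simp add: case_prod_beta' ennreal_mult'')
  have h[measurable]: "?h \<in> borel_measurable (lborel \<Otimes>\<^sub>M lborel)"
    by measurable
  have intX: "integrable M X"
    using distributed_integrable[OF X, of "\<lambda>x. x"] integrable_normal_moment[of \<sigma> 0 1] \<sigma> by simp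
  \<comment> \<open>\<open>?h\<close> equals its first argument on the half-plane and 0 elsewhere,
    so it is dominated by the absolute value of \<open>X\<close>. This gives the integrability that
    Fubini needs.\<close>
  have intM: "integrable M (\<lambda>\<omega>. ?h (X \<omega>, Y \<omega>))"
    by (rule Bochner_Integration.integrable_bound[OF intX]) (auto simp: indicator_def)
  have int: "integrable (lborel \<Otimes>\<^sub>M lborel) (\<lambda>p. (?f (fst p) * ?g (snd p)) * ?h p)"
    using distributed_integrable[OF XY h] intM by simp
  have int': "integrable (lborel \<Otimes>\<^sub>M lborel) (\<lambda>(x, y). (?f x * ?g y) * (indicator {c..} (x + y) * x))"
    using int by (simp add: case_prod_beta')
  have "(LINT \<omega>:{\<omega> \<in> space M. c \<le> X \<omega> + Y \<omega>}|M. X \<omega>) = (\<integral>\<omega>. ?h (X \<omega>, Y \<omega>) \<partial>M)"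
    unfolding set_lebesgue_integral_def by (rule Bochner_Integration.integral_cong) (auto simp: indicator_def)
  also have "\<dots> = (\<integral>p. (?f (fst p) * ?g (snd p)) * ?h p \<partial>(lborel \<Otimes>\<^sub>M lborel))"
    by (rule distributed_integral[OF XY h, symmetric]) simp
  also have "\<dots> = (\<integral>p. (\<lambda>(x, y). (?f x * ?g y) * (indicator {c..} (x + y) * x)) p \<partial>(lborel \<Otimes>\<^sub>M lborel))"
    by (simp add: case_prod_beta')
  \<comment> \<open>By Fubini \<open>x\<close> is integrated first: for fixed \<open>y\<close> the
    constraint becomes the half-line from \<open>c - y\<close>, to which the truncated moment
    applies.\<close>
  also have "\<dots> = (\<integral>y. (\<integral>x. (?f x * ?g y) * (indicator {c..} (x + y) * x) \<partial>lborel) \<partial>lborel)"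
    by (rule lborel_pair.integral_snd[OF int', symmetric])
  also have "\<dots> = (\<integral>y. \<sigma>\<^sup>2 * (?f (c - y) * ?g y) \<partial>lborel)"
  proof (rule Bochner_Integration.integral_cong[OF refl])
    fix y :: real
    have "(\<integral>x. (?f x * ?g y) * (indicator {c..} (x + y) * x) \<partial>lborel) =
        (\<integral>x. ?g y * (indicator {c - y..} x *\<^sub>R (?f x * x)) \<partial>lborel)"
      by (rule Bochner_Integration.integral_cong) (auto simp: indicator_def)
    also have "\<dots> = ?g y * (LINT x:{c - y..}|lborel. ?f x * x)"
      unfolding set_lebesgue_integral_def by simp
    finally show "(\<integral>x. (?f x * ?g y) * (indicator {c..} (x + y) * x) \<partial>lborel) = \<sigma>\<^sup>2 * (?f (c - y) * ?g y)"
      by (simp add: truncated_normal_moment[OF \<sigma>])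
  qed
  also have "\<dots> = \<sigma>\<^sup>2 * (\<integral>y. ?f (c - y) * ?g y \<partial>lborel)"
    by simp
  \<comment> \<open>What remains is the convolution of two normal densities; it is rewritten as a
    nonnegative integral to match the form of the convolution identity.\<close>
  also have "(\<integral>y. ?f (c - y) * ?g y \<partial>lborel) = enn2real (\<integral>\<^sup>+y. ennreal (?f (c - y) * ?g y) \<partial>lborel)"
    by (rule integral_eq_nn_integral) auto
  also have "\<dots> = normal_density 0 (sqrt (\<sigma>\<^sup>2 + \<tau>\<^sup>2)) c"
    using fun_cong[OF conv_normal_density_zero_mean[OF \<sigma> \<tau>], of c] by simp
  finally show ?thesis .
qed

text \<open>The summand \<open>w i * X i\<close> is split off, and the rest of the sum is an
  independent centred normal unless it vanishes. Stating this for a finite family treats type and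
  soft skill alike, and nonnegative weights cover a score without noise.\<close>

lemma (in prob_space) truncated_expectation_linear_combination:
  fixes X :: "'i \<Rightarrow> 'a \<Rightarrow> real" and w :: "'i \<Rightarrow> real"
  assumes I: "finite I" and indep: "indep_vars (\<lambda>_. borel) X I"
    and X: "\<And>j. j \<in> I \<Longrightarrow> distributed M lborel (X j) std_normal_density"
    and w: "\<And>j. j \<in> I \<Longrightarrow> 0 \<le> w j" and i: "i \<in> I" "0 < w i"
  shows "(LINT \<omega>:{\<omega> \<in> space M. c \<le> (\<Sum>j\<in>I. w j * X j \<omega>)}|M. X i \<omega>) =
    w i * normal_density 0 (sqrt (\<Sum>j\<in>I. (w j)\<^sup>2)) c"
proof -
  \<comment> \<open>Only positive weights are kept, because a summand with weight 0 is constant and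
    has no density.\<close>
  define J where "J = {j \<in> I - {i}. 0 < w j}"
  define Y where "Y = (\<lambda>j \<omega>. w j * X j \<omega>)"
  have J: "finite J" "i \<notin> J" "insert i J \<subseteq> I"
    using I i by (auto simp: J_def)
  have zero: "w j = 0" if "j \<in> I - insert i J" for j
    using that w[of j] by (force simp: J_def)
  \<comment> \<open>Used twice below: for the weighted sum of the variables and for the sum of
    squared weights.\<close>
  have Isum: "(\<Sum>j\<in>I. g j) = g i + (\<Sum>j\<in>J. g j)" if "\<And>j. w j = 0 \<Longrightarrow> g j = 0" for g :: "'i \<Rightarrow> real"
  proof -
    have "(\<Sum>j\<in>I. g j) = (\<Sum>j\<in>insert i J. g j)"
      using I J zero that by (intro sum.mono_neutral_right) auto
    then show ?thesis using J by simp
  qed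
  have ind: "indep_vars (\<lambda>_. borel) Y (insert i J)"
    unfolding Y_def by (intro indep_vars_compose2[OF indep_vars_subset[OF indep J(3)]]) simp
  have Y: "distributed M lborel (Y j) (normal_density 0 (w j))" if "j \<in> insert i J" for j
    using normal_density_affine[OF X[of j], of "w j" 0] that J i
    by (auto simp: Y_def J_def)
  have key: "(LINT \<omega>:{\<omega> \<in> space M. c \<le> Y i \<omega> + (\<Sum>j\<in>J. Y j \<omega>)}|M. Y i \<omega>) =
    (w i)\<^sup>2 * normal_density 0 (sqrt ((w i)\<^sup>2 + (\<Sum>j\<in>J. (w j)\<^sup>2))) c"
  \<comment> \<open>With \<open>J\<close> empty the rest is the constant 0, which has no density, so
    the two-variable lemma is replaced by the truncated moment of \<open>Y i\<close> alone.\<close>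
  proof (cases "J = {}")
    case True
    have "(LINT \<omega>:{\<omega> \<in> space M. c \<le> Y i \<omega>}|M. Y i \<omega>) = (\<integral>\<omega>. (\<lambda>x. indicator {c..} x * x) (Y i \<omega>) \<partial>M)"
      unfolding set_lebesgue_integral_def by (rule Bochner_Integration.integral_cong) (auto simp: indicator_def)
    also have "\<dots> = (\<integral>x. normal_density 0 (w i) x * (indicator {c..} x * x) \<partial>lborel)"
      by (rule distributed_integral[OF Y, symmetric]) auto
    also have "\<dots> = (LINT x:{c..}|lborel. normal_density 0 (w i) x * x)"
      unfolding set_lebesgue_integral_def by (rule Bochner_Integration.integral_cong) (auto simp: indicator_def)
    finally show ?thesis
      using True i by (simp add: truncated_normal_moment)
  next
    case False
    have pos: "0 < (\<Sum>j\<in>J. (w j)\<^sup>2)"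
      using J(1) False by (intro sum_pos) (auto simp: J_def)
    have "distributed M lborel (\<lambda>\<omega>. \<Sum>j\<in>J. Y j \<omega>) (normal_density (\<Sum>j\<in>J. 0) (sqrt (\<Sum>j\<in>J. (w j)\<^sup>2)))"
      using J(1) False indep_vars_subset[OF ind subset_insertI] Y
      by (intro sum_indep_normal) (auto simp: J_def)
    then show ?thesis
      using truncated_expectation_indep_normal[OF indep_vars_sum[OF J(1,2) ind] i(2) _ Y, of "sqrt (\<Sum>j\<in>J. (w j)\<^sup>2)" c] pos
      by simp
  qed
  \<comment> \<open>\<open>key\<close> concerns the scaled variable \<open>Y i\<close>; cancelling
    one positive factor \<open>w i\<close> turns its variance into the single \<open>w i\<close> of
    the claim.\<close>
  have "w i * (LINT \<omega>:{\<omega> \<in> space M. c \<le> (\<Sum>j\<in>I. w j * X j \<omega>)}|M. X i \<omega>) =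
      (LINT \<omega>:{\<omega> \<in> space M. c \<le> Y i \<omega> + (\<Sum>j\<in>J. Y j \<omega>)}|M. Y i \<omega>)"
    by (subst Isum) (simp_all add: Y_def)
  also have "\<dots> = w i * (w i * normal_density 0 (sqrt (\<Sum>j\<in>I. (w j)\<^sup>2)) c)"
    unfolding key by (subst Isum) (simp_all add: power2_eq_square)
  finally show ?thesis using i by simp
qed

section \<open>Conditional expectation determined by upper tails\<close>

text \<open>Dynkin's pi-lambda argument: closed upper half-lines are stable under intersection and
  generate the Borel sets, and the sets with equal integrals form a lambda-system.\<close>

lemma (in prob_space) set_integral_vimage_eqI_atLeast:
  fixes A f g :: "'a \<Rightarrow> real"
  assumes [measurable]: "random_variable borel A" and f: "integrable M f" and g: "integrable M g"
    and total: "expectation f = expectation g"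
    and tails: "\<And>c. (LINT \<omega>:A -` {c..} \<inter> space M|M. f \<omega>) = (LINT \<omega>:A -` {c..} \<inter> space M|M. g \<omega>)"
    and B: "B \<in> sets borel"
  shows "(LINT \<omega>:A -` B \<inter> space M|M. f \<omega>) = (LINT \<omega>:A -` B \<inter> space M|M. g \<omega>)"
proof -
  have borel: "sets (borel :: real measure) = sigma_sets UNIV (range atLeast)"
    by (simp add: borel_Ici)
  have integ: "set_integrable M S u" if "integrable M u" "S \<in> sets M" for u :: "'a \<Rightarrow> real" and S
    using that unfolding set_integrable_def by (intro integrable_mult_indicator)
  have "{a..} \<inter> {b..} = {max a b..}" for a b :: real
    by auto
  then have "Int_stable (range (atLeast :: real \<Rightarrow> _))"
    by (auto simp: Int_stable_def)
  moreover have "range (atLeast :: real \<Rightarrow> _) \<subseteq> Pow UNIV"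
    by simp
  ultimately show ?thesis
    using B[unfolded borel]
  proof (induction B rule: sigma_sets_induct_disjoint)
    case (basic B)
    then show ?case using tails by auto
  next
    case empty
    then show ?case by (simp add: set_lebesgue_integral_def)
  next
    \<comment> \<open>The integral over the complement is the total minus the integral over
      \<open>B\<close>; this is where equality of the expectations enters.\<close>
    case (compl B)
    then have [measurable]: "B \<in> sets borel" by (simp add: borel)
    have "(LINT \<omega>:A -` (UNIV - B) \<inter> space M|M. u \<omega>) = expectation u - (LINT \<omega>:A -` B \<inter> space M|M. u \<omega>)"
      if u: "integrable M u" for u :: "'a \<Rightarrow> real"
    proof -
      have "expectation u = (LINT \<omega>:(A -` (UNIV - B) \<inter> space M) \<union> (A -` B \<inter> space M)|M. u \<omega>)"
        unfolding set_lebesgue_integral_def by (rule Bochner_Integration.integral_cong) auto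
      also have "\<dots> = (LINT \<omega>:A -` (UNIV - B) \<inter> space M|M. u \<omega>) + (LINT \<omega>:A -` B \<inter> space M|M. u \<omega>)"
        by (rule set_integral_Un) (auto intro!: integ u)
      finally show ?thesis by simp
    qed
    then show ?case using compl(2) total f g by simp
  next
    case (union B)
    then have [measurable]: "B i \<in> sets borel" for i by (auto simp: borel)
    have "(LINT \<omega>:A -` (\<Union>i. B i) \<inter> space M|M. u \<omega>) = (\<Sum>i. LINT \<omega>:A -` B i \<inter> space M|M. u \<omega>)"
      if u: "integrable M u" for u :: "'a \<Rightarrow> real"
    proof -
      have eq: "A -` (\<Union>i. B i) \<inter> space M = (\<Union>i. A -` B i \<inter> space M)" by auto
      have "set_integrable M (\<Union>i. A -` B i \<inter> space M) u" by (intro integ u) measurable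
      then show ?thesis unfolding eq
        using union(1) by (intro lebesgue_integral_countable_add) (auto simp: disjoint_family_on_def)
    qed
    then show ?case using union(3) f g by simp
  qed
qed

text \<open>Every event in the sigma-algebra of \<open>A\<close> is the preimage of a Borel set, so
  agreement on upper tails extends to all of them. As \<phi>(A) is measurable for that
  sigma-algebra, it is a version of the conditional expectation.\<close>

lemma (in prob_space) real_cond_exp_vimage_eqI_atLeast:
  fixes A f :: "'a \<Rightarrow> real" and \<phi> :: "real \<Rightarrow> real"
  assumes A[measurable]: "random_variable borel A" and \<phi>[measurable]: "\<phi> \<in> borel_measurable borel"
    and f: "integrable M f" and g: "integrable M (\<lambda>\<omega>. \<phi> (A \<omega>))"
    and total: "expectation f = expectation (\<lambda>\<omega>. \<phi> (A \<omega>))"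
    and tails: "\<And>c. (LINT \<omega>:A -` {c..} \<inter> space M|M. f \<omega>) = (LINT \<omega>:A -` {c..} \<inter> space M|M. \<phi> (A \<omega>))"
  shows "AE \<omega> in M. real_cond_exp M (vimage_algebra (space M) A borel) f \<omega> = \<phi> (A \<omega>)"
proof -
  let ?F = "vimage_algebra (space M) A borel"
  have F: "sets ?F = {A -` B \<inter> space M | B. B \<in> sets borel}"
    by (rule sets_vimage_algebra2) simp
  interpret finite_measure_subalgebra M ?F
    by standard (auto simp: subalgebra_def F)
  have [measurable]: "A \<in> measurable ?F borel"
    by (rule measurable_vimage_algebra1) simp
  show ?thesis
  proof (rule real_cond_exp_charact)
    fix S assume "S \<in> sets ?F"
    then show "(LINT \<omega>:S|M. f \<omega>) = (LINT \<omega>:S|M. \<phi> (A \<omega>))"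
      unfolding F using set_integral_vimage_eqI_atLeast[OF A f g total tails] by auto
  qed (use f g in auto)
qed


theorem corollary3:
  fixes M :: "'a measure" and t s Z :: "'a \<Rightarrow> real" and \<sigma>\<^sub>Z :: real
  assumes "prob_space M"
    and "prob_space.indep_vars M (\<lambda>_. borel) (\<lambda>i. [t, s, Z] ! i) {..<3::nat}"
    and "distributed M lborel t std_normal_density"
    and "distributed M lborel s std_normal_density"
    and "distributed M lborel Z std_normal_density"
    and "\<sigma>\<^sub>Z \<ge> 0"
  shows "\<exists>r :: real \<Rightarrow> real.
    (\<forall>\<alpha>\<in>{0<..<1}. \<forall>\<beta>\<in>{0<..<1}. \<forall>\<tau>\<^sub>Q :: real.
      \<forall>E\<in>{admitted M t s Z \<sigma>\<^sub>Z \<alpha> \<beta> \<tau>\<^sub>Q, above_threshold M t s Z \<sigma>\<^sub>Z \<alpha> \<beta> \<tau>\<^sub>Q}.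
        measure M E > 0 \<and> event_mean M s E \<noteq> 0 \<and>
        event_mean M t E / event_mean M s E = r \<alpha>) \<and>
    (\<exists>\<alpha>\<^sub>1\<in>{0<..<1}. \<exists>\<alpha>\<^sub>2\<in>{0<..<1}. r \<alpha>\<^sub>1 \<noteq> r \<alpha>\<^sub>2)"
proof -
  interpret prob_space M by fact
  have [measurable]: "random_variable borel t" "random_variable borel s" "random_variable borel Z"
    using assms(3-5) distributed_measurable by fastforce+
  have int: "integrable M t" "integrable M s" "integrable M Z"
    using assms(3-5) integrable_std_normal_moment[of 1]
    by (auto intro!: distributed_integrable_var[where f = std_normal_density])
  have zero: "expectation t = 0" "expectation s = 0" "expectation Z = 0"
    using assms(3-5) by (auto intro: standard_normal_distributed_expectation)
  have lin: "(LINT \<omega>:S|M. a * u \<omega> + b * w \<omega>) = a * (LINT \<omega>:S|M. u \<omega>) + b * (LINT \<omega>:S|M. w \<omega>)"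
    if "integrable M u" "integrable M w" "S \<in> sets M" for u w :: "'a \<Rightarrow> real" and a b :: real and S
  proof -
    have "set_integrable M S u" "set_integrable M S w"
      using that unfolding set_integrable_def by (auto intro!: integrable_mult_indicator simp del: real_scaleR_def)
    then show ?thesis
      by (subst set_integral_add) (auto intro!: set_integrable_mult_right)
  qed
  \<comment> \<open>The integrals of \<open>t\<close> and \<open>s\<close> over \<open>E\<close> are
    \<alpha> and 1 - \<alpha> times the same density value; this value and the probability of
    \<open>E\<close> cancel in the quotient.\<close>
  have ratio: "measure M E > 0 \<and> event_mean M s E \<noteq> 0 \<and>
      event_mean M t E / event_mean M s E = \<alpha> / (1 - \<alpha>)"
    if \<alpha>: "\<alpha> \<in> {0<..<1}" and \<beta>: "\<beta> \<in> {0<..<1}"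
      and E: "E \<in> {admitted M t s Z \<sigma>\<^sub>Z \<alpha> \<beta> \<tau>\<^sub>Q, above_threshold M t s Z \<sigma>\<^sub>Z \<alpha> \<beta> \<tau>\<^sub>Q}"
    for \<alpha> \<beta> \<tau>\<^sub>Q :: real and E
  proof -
    define v where "v = \<alpha>\<^sup>2 + (1 - \<alpha>)\<^sup>2 + \<sigma>\<^sub>Z\<^sup>2"
    define A where "A = admission_score \<alpha> \<sigma>\<^sub>Z t s Z"
    define f where "f = normal_density 0 (sqrt v)"
    \<comment> \<open>The regression coefficient of quality on score: the numerator is their
      covariance and \<open>v\<close> is the variance of the score. The admission threshold is then
      \<open>\<tau>\<^sub>Q / k\<close>.\<close>
    define k where "k = (\<alpha> * \<beta> + (1 - \<alpha>) * (1 - \<beta>)) / v"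
    have "0 < \<alpha> * \<beta>" "0 < (1 - \<alpha>) * (1 - \<beta>)"
      using \<alpha> \<beta> by auto
    moreover have v: "0 < v"
      using \<alpha> by (auto simp: v_def intro!: add_pos_nonneg)
    ultimately have k: "0 < k"
      by (simp add: k_def)
    have f: "0 < f c" for c
      using v by (simp add: f_def normal_density_pos)
    have A_eq: "A = (\<lambda>\<omega>. \<alpha> * t \<omega> + (1 - \<alpha>) * s \<omega> + \<sigma>\<^sub>Z * Z \<omega>)"
      by (simp add: A_def admission_score_def)
    have A[measurable]: "random_variable borel A"
      unfolding A_eq by measurable
    let ?S = "\<lambda>c. A -` {c..} \<inter> space M"
    have S[measurable]: "?S c \<in> sets M" for c
      by measurable
    have tail: "(LINT \<omega>:?S c|M. ([t, s, Z] ! i) \<omega>) = ([\<alpha>, 1 - \<alpha>, \<sigma>\<^sub>Z] ! i) * f c"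
      if i: "i < 3" "0 < [\<alpha>, 1 - \<alpha>, \<sigma>\<^sub>Z] ! i" for i c
    proof -
      have "{\<omega> \<in> space M. c \<le> (\<Sum>j<3. [\<alpha>, 1 - \<alpha>, \<sigma>\<^sub>Z] ! j * ([t, s, Z] ! j) \<omega>)} = ?S c"
        by (auto simp: A_eq eval_nat_numeral)
      moreover have "(\<Sum>j<3. ([\<alpha>, 1 - \<alpha>, \<sigma>\<^sub>Z] ! j)\<^sup>2) = v"
        by (simp add: v_def eval_nat_numeral)
      moreover have "distributed M lborel ([t, s, Z] ! j) std_normal_density" if "j < 3" for j
        using that assms(3-5) by (auto simp: less_Suc_eq eval_nat_numeral)
      moreover have "0 \<le> [\<alpha>, 1 - \<alpha>, \<sigma>\<^sub>Z] ! j" if "j < 3" for j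
        using that \<alpha> assms(6) by (auto simp: less_Suc_eq eval_nat_numeral)
      ultimately show ?thesis
        using truncated_expectation_linear_combination[OF _ assms(2), of "\<lambda>j. [\<alpha>, 1 - \<alpha>, \<sigma>\<^sub>Z] ! j" i c] i
        by (simp add: f_def)
    qed
    have t: "(LINT \<omega>:?S c|M. t \<omega>) = \<alpha> * f c" for c
      using tail[of 0 c] \<alpha> by simp
    have s: "(LINT \<omega>:?S c|M. s \<omega>) = (1 - \<alpha>) * f c" for c
      using tail[of 1 c] \<alpha> by simp
    \<comment> \<open>The extra factor \<open>\<sigma>\<^sub>Z\<close> keeps the identity valid for
      zero noise, where \<open>tail\<close> does not apply.\<close>
    have Z: "\<sigma>\<^sub>Z * (LINT \<omega>:?S c|M. Z \<omega>) = \<sigma>\<^sub>Z\<^sup>2 * f c" for c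
      using tail[of 2 c] assms(6) by (cases "\<sigma>\<^sub>Z = 0") (auto simp: power2_eq_square)
    have tailA: "(LINT \<omega>:?S c|M. A \<omega>) = v * f c" for c
    proof -
      have "(LINT \<omega>:?S c|M. A \<omega>) = \<alpha> * (LINT \<omega>:?S c|M. t \<omega>) + (1 - \<alpha>) * (LINT \<omega>:?S c|M. s \<omega>)
          + \<sigma>\<^sub>Z * (LINT \<omega>:?S c|M. Z \<omega>)"
        using lin[of "\<lambda>\<omega>. \<alpha> * t \<omega> + (1 - \<alpha>) * s \<omega>" Z "?S c" 1 \<sigma>\<^sub>Z] int
        by (simp add: lin A_eq[symmetric] del: S)
      then show ?thesis
        by (simp add: t s Z v_def power2_eq_square algebra_simps)
    qed
    have tailQ: "(LINT \<omega>:?S c|M. quality \<beta> t s \<omega>) = (LINT \<omega>:?S c|M. k * A \<omega>)" for c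
    proof -
      have "(LINT \<omega>:?S c|M. quality \<beta> t s \<omega>) =
          \<beta> * (LINT \<omega>:?S c|M. t \<omega>) + (1 - \<beta>) * (LINT \<omega>:?S c|M. s \<omega>)"
        unfolding quality_def by (intro lin int S)
      also have "\<dots> = k * (v * f c)"
        using v by (simp add: t s k_def field_simps)
      finally show ?thesis by (simp add: tailA)
    qed
    have cond: "AE \<omega> in M. real_cond_exp M (vimage_algebra (space M) A borel) (quality \<beta> t s) \<omega> = k * A \<omega>"
    proof (rule real_cond_exp_vimage_eqI_atLeast[OF A _ _ _ _ tailQ])
      show "integrable M (quality \<beta> t s)" "integrable M (\<lambda>\<omega>. k * A \<omega>)"
        using int by (auto simp: quality_def A_eq)
      show "expectation (quality \<beta> t s) = expectation (\<lambda>\<omega>. k * A \<omega>)"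
        using int zero by (simp add: quality_def A_eq)
    qed simp
    define c where "c = admission_threshold \<sigma>\<^sub>Z \<alpha> \<beta> \<tau>\<^sub>Q"
    have c: "c = \<tau>\<^sub>Q / k"
      by (simp add: c_def admission_threshold_def k_def v_def)
    have above: "above_threshold M t s Z \<sigma>\<^sub>Z \<alpha> \<beta> \<tau>\<^sub>Q = ?S c"
      by (auto simp: above_threshold_def A_def c_def)
    have Em: "E \<in> sets M"
      using E unfolding above admitted_def A_def[symmetric] by auto
    \<comment> \<open>A conditional expectation is fixed only up to null sets, so the admission
      event is compared with the tail event almost everywhere. Positivity of \<open>k\<close> allows
      dividing the inequality by it.\<close>
    have "AE \<omega> in M. \<omega> \<in> E \<longleftrightarrow> \<omega> \<in> ?S c"
    proof (cases "E = ?S c")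
      case False
      then have E_eq: "E = admitted M t s Z \<sigma>\<^sub>Z \<alpha> \<beta> \<tau>\<^sub>Q"
        using E above by auto
      show ?thesis
        using cond AE_space
      proof eventually_elim
        case (elim \<omega>)
        then show ?case
          using k by (auto simp: E_eq admitted_def A_def[symmetric] c field_simps)
      qed
    qed simp
    then have same: "(LINT \<omega>:E|M. u \<omega>) = (LINT \<omega>:?S c|M. u \<omega>)" if [measurable]: "random_variable borel u" for u :: "'a \<Rightarrow> real"
      using Em by (intro set_integral_cong_set) (auto simp: set_borel_measurable_def)
    have s_pos: "0 < (LINT \<omega>:E|M. s \<omega>)"
      using \<alpha> f by (simp add: same s)
    \<comment> \<open>Over a null event the integral of \<open>s\<close> would vanish, contradicting
      \<open>s_pos\<close>.\<close>
    have "measure M E \<noteq> 0"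
    proof
      assume "measure M E = 0"
      then have "AE \<omega> in M. \<omega> \<notin> E"
        using Em by (intro AE_not_in) (auto simp: null_sets_def emeasure_eq_measure)
      then have "(LINT \<omega>:E|M. s \<omega>) = (LINT \<omega>:{}|M. s \<omega>)"
        using Em by (intro set_integral_cong_set) (auto simp: set_borel_measurable_def)
      with s_pos show False by (simp add: set_lebesgue_integral_def)
    qed
    then have "0 < measure M E"
      by (simp add: zero_less_measure_iff)
    moreover from this have "event_mean M s E \<noteq> 0"
      using s_pos by (simp add: event_mean_def)
    moreover have "event_mean M t E / event_mean M s E = \<alpha> / (1 - \<alpha>)"
      using \<open>0 < measure M E\<close> f[of c] \<alpha> by (simp add: event_mean_def same t s)
    ultimately show ?thesis by blast
  qed
  \<comment> \<open>Dependence on \<alpha>: the weights 1/2 and 1/3 give the ratios 1 and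
    1/2.\<close>
  have "(1 / 2 :: real) / (1 - 1 / 2) \<noteq> (1 / 3) / (1 - 1 / 3)"
    by simp
  moreover have "(1 / 2 :: real) \<in> {0<..<1}" "(1 / 3 :: real) \<in> {0<..<1}"
    by auto
  ultimately show ?thesis
    using ratio by (intro exI[of _ "\<lambda>\<alpha>. \<alpha> / (1 - \<alpha>)"]) blast
qed

end
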